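(* Let $h,k\in\{0,1,2\}$ with $h+k\ge1$. For every positive integer $n$, the number of ways to place two unlabelled nonattacking partial queens $\mathsf{Q}^{hk}$ on the $n\times n$ board is $$u_{\mathsf{Q}^{hk}}(2;n)=\frac12n^4-\frac{3h+2k}{6}n^3+\frac{h+k-1}{2}n^2-\frac k6n.$$
   Context: The board is $[n]^2$ with $[n]=\{1,\dots,n\}$. A partial queen $\mathsf{Q}^{hk}$ has basic move set consisting of $h$ vectors from $\{(1,0),(0,1)\}$ and $k$ vectors from $\{(1,1),(1,-1)\}$. A piece at $z_i$ attacks a piece at $z_j$ if $z_j-z_i$ is a multiple of some basic move (so two pieces on the same square attack each other). $u_{\mathsf{Q}^{hk}}(q;n)$ is the number of placements of $q$ unlabelled pairwise nonattacking pieces on $[n]^2$. *)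

theory Defs
  imports Complex_Main "HOL-Library.Multiset" "HOL-Library.Product_Plus"
begin

definition board :: "nat \<Rightarrow> (int \<times> int) set" where
  "board n = {1..int n} \<times> {1..int n}"

text \<open>The numbers \<open>h\<close> and \<open>k\<close> do not determine the move set when one of them is 1, so
  ``being a basic move set of the partial queen with parameters \<open>h\<close>, \<open>k\<close>'' is a predicate.\<close>

definition partial_queen_moves :: "nat \<Rightarrow> nat \<Rightarrow> (int \<times> int) set \<Rightarrow> bool" where
  "partial_queen_moves h k M \<longleftrightarrow>
     (\<exists>H D. H \<subseteq> {(1, 0), (0, 1)} \<and> card H = h \<and>
            D \<subseteq> {(1, 1), (1, -1)} \<and> card D = k \<and>
            M = H \<union> D)"

text \<open>The multiplier ranges over all integers, including 0 and negative ones: pieces move in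
  both directions, and (if there is any move) two pieces on the same square attack each other.
  All moves used here have coprime coordinates, so real multipliers would give nothing more.\<close>

definition attacks :: "(int \<times> int) set \<Rightarrow> int \<times> int \<Rightarrow> int \<times> int \<Rightarrow> bool" where
  "attacks M z w \<longleftrightarrow> (\<exists>(a, b) \<in> M. \<exists>c::int. w - z = (c * a, c * b))"

definition labelled_placements :: "(int \<times> int) set \<Rightarrow> nat \<Rightarrow> nat \<Rightarrow> (int \<times> int) list set" where
  "labelled_placements M q n =
     {zs. length zs = q \<and> set zs \<subseteq> board n \<and>
          (\<forall>i<q. \<forall>j<q. i \<noteq> j \<longrightarrow> \<not> attacks M (zs ! i) (zs ! j))}"

text \<open>Forgetting the labels sends a list of positions to its multiset. The definition does not
  presuppose distinct positions; distinctness follows from nonattack when \<open>M\<close> is nonempty.\<close>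

definition u_placements :: "(int \<times> int) set \<Rightarrow> nat \<Rightarrow> nat \<Rightarrow> nat" where
  "u_placements M q n = card (mset ` labelled_placements M q n)"

end

theory Submission
  imports Defs
begin

text \<open>Count ordered pairs of squares. Two distinct squares attack each other along at most one basic
  move, so the attacking pairs split by move \<open>m\<close> and then by multiplier \<open>c \<noteq> 0\<close>. A square \<open>z\<close> and its
  translate \<open>z + c m\<close> both lie on the board for \<open>n (n - \<bar>c\<bar>)\<close> choices of \<open>z\<close> when \<open>m\<close> is horizontal or
  vertical and for \<open>(n - \<bar>c\<bar>)\<^sup>2\<close> choices when it is diagonal. Summing over \<open>c\<close>, subtracting from
  \<open>n\<^sup>4 - n\<^sup>2\<close> and halving gives the formula.\<close>

text \<open>Forgetting the order is exactly two-to-one here: symmetry puts both orders into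
  \<open>P\<close>, and irreflexivity excludes \<open>{#x, x#}\<close>, which has only one
  order.\<close>

lemma card_pairs_eq_twice_card_mset:
  assumes "finite P" and sym: "\<And>x y. (x, y) \<in> P \<Longrightarrow> (y, x) \<in> P" and irrefl: "\<And>x. (x, x) \<notin> P"
  shows "card P = 2 * card ((\<lambda>(x, y). {#x, y#}) ` P)"
proof -
  let ?f = "\<lambda>(x, y). {#x, y#}"
  have fibre: "card {p \<in> P. ?f p = m} = 2" if "m \<in> ?f ` P" for m
  proof -
    obtain x y where xy: "(x, y) \<in> P" "m = {#x, y#}"
      using \<open>m \<in> ?f ` P\<close> by auto
    have "x \<noteq> y"
      using xy irrefl by auto
    have "{p \<in> P. ?f p = m} = {(x, y), (y, x)}"
      using xy sym by (auto simp: add_eq_conv_ex)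
    then show ?thesis
      using \<open>x \<noteq> y\<close> by simp
  qed
  have "card P = (\<Sum>m\<in>?f ` P. card {p \<in> P. ?f p = m})"
    using sum.image_gen[OF \<open>finite P\<close>, of "\<lambda>_. 1::nat" ?f] by simp
  also have "\<dots> = 2 * card (?f ` P)"
    using fibre by simp
  finally show ?thesis .
qed

text \<open>Requiring \<open>c \<noteq> 0\<close> keeps equal squares out, so that pairs
  \<open>(z, z)\<close> are counted once and not once per move.\<close>

definition attacking_pairs :: "int \<times> int \<Rightarrow> nat \<Rightarrow> ((int \<times> int) \<times> int \<times> int) set" where
  "attacking_pairs m n =
     {(z, w). z \<in> board n \<and> w \<in> board n \<and> (\<exists>c. c \<noteq> 0 \<and> w - z = (c * fst m, c * snd m))}"

section \<open>Pairs of squares with a prescribed displacement\<close>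

lemma finite_board: "finite (board n)"
  by (simp add: board_def)

lemma card_board: "card (board n) = n ^ 2"
  by (simp add: board_def power2_eq_square)

lemma finite_attacking_pairs: "finite (attacking_pairs m n)"
  by (rule finite_subset[of _ "board n \<times> board n"]) (auto simp: attacking_pairs_def finite_board)

text \<open>The overlap of an interval with its translate is again an interval; it is empty when
  \<open>\<bar>d\<bar> \<ge> n\<close>, where \<open>nat\<close> returns 0.\<close>

lemma card_interval_Int_translate:
  "card {x. x \<in> {1..int n} \<and> x + d \<in> {1..int n}} = nat (int n - \<bar>d\<bar>)"
proof -
  have "{x. x \<in> {1..int n} \<and> x + d \<in> {1..int n}} = {max 1 (1 - d)..min (int n) (int n - d)}"
    by auto
  moreover have "min (int n) (int n - d) + 1 - max 1 (1 - d) = int n - \<bar>d\<bar>"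
    by auto
  ultimately show ?thesis
    by simp
qed

lemma card_board_Int_translate:
  "card {z \<in> board n. z + (d, e) \<in> board n} = nat (int n - \<bar>d\<bar>) * nat (int n - \<bar>e\<bar>)"
proof -
  have "{z \<in> board n. z + (d, e) \<in> board n} =
      {x. x \<in> {1..int n} \<and> x + d \<in> {1..int n}} \<times> {y. y \<in> {1..int n} \<and> y + e \<in> {1..int n}}"
    by (auto simp: board_def)
  then show ?thesis
    by (simp only: card_cartesian_product card_interval_Int_translate)
qed

lemma sum_nonzero_abs:
  fixes f :: "int \<Rightarrow> nat"
  assumes "\<And>c. f (- c) = f c"
  shows "(\<Sum>c\<in>{- int n..int n} - {0}. f c) = 2 * (\<Sum>j=1..n. f (int j))"
proof (induction n)
  case 0
  then show ?case by simp
next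
  case (Suc n)
  have "{- int (Suc n)..int (Suc n)} - {0} =
      insert (int (Suc n)) (insert (- int (Suc n)) ({- int n..int n} - {0}))"
    by auto
  then show ?case
    using Suc assms[of "int (Suc n)"] by simp
qed

text \<open>A coordinate of absolute value 1 makes the multiplier recoverable from the displacement,
  so attacking pairs correspond bijectively to pairs of a multiplier and a starting square.\<close>

lemma card_attacking_pairs:
  assumes "\<bar>a\<bar> = 1 \<or> \<bar>b\<bar> = 1"
  shows "card (attacking_pairs (a, b) n) =
    2 * (\<Sum>j=1..n. nat (int n - int j * \<bar>a\<bar>) * nat (int n - int j * \<bar>b\<bar>))"
proof -
  let ?C = "{- int n..int n} - {0}"
  let ?Z = "\<lambda>c. {z \<in> board n. z + (c * a, c * b) \<in> board n}"
  let ?g = "\<lambda>(c, z). (z, z + (c * a, c * b))"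
  have "inj_on ?g (SIGMA c:?C. ?Z c)"
    using assms by (auto simp: inj_on_def)
  moreover have "?g ` (SIGMA c:?C. ?Z c) = attacking_pairs (a, b) n"
  proof
    show "?g ` (SIGMA c:?C. ?Z c) \<subseteq> attacking_pairs (a, b) n"
      by (auto simp: attacking_pairs_def)
    show "attacking_pairs (a, b) n \<subseteq> ?g ` (SIGMA c:?C. ?Z c)"
    proof
      fix p
      assume "p \<in> attacking_pairs (a, b) n"
      then obtain z w c where p: "p = (z, w)" "z \<in> board n" "w \<in> board n" "c \<noteq> 0"
        "w - z = (c * a, c * b)"
        by (auto simp: attacking_pairs_def)
      then have w: "w = z + (c * a, c * b)"
        by (metis add.commute diff_add_cancel)
      \<comment> \<open>The sharp bound is \<open>n - 1\<close>; the extra multipliers of absolute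
        value \<open>n\<close> contribute only zero terms.\<close>
      have "\<bar>c * a\<bar> \<le> int n" "\<bar>c * b\<bar> \<le> int n"
        using p by (auto simp: board_def abs_le_iff)
      then have "\<bar>c\<bar> \<le> int n"
        using assms by (auto simp: abs_mult)
      then have "(c, z) \<in> (SIGMA c:?C. ?Z c)"
        using p w by auto
      moreover have "p = ?g (c, z)"
        using p w by simp
      ultimately show "p \<in> ?g ` (SIGMA c:?C. ?Z c)"
        by blast
    qed
  qed
  ultimately have "card (attacking_pairs (a, b) n) = card (SIGMA c:?C. ?Z c)"
    using card_image[of ?g "SIGMA c:?C. ?Z c"] by simp
  also have "\<dots> = (\<Sum>c\<in>?C. card (?Z c))"
    by (intro card_SigmaI) (auto simp: finite_board)
  also have "\<dots> = (\<Sum>c\<in>?C. nat (int n - \<bar>c * a\<bar>) * nat (int n - \<bar>c * b\<bar>))"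
    by (simp only: card_board_Int_translate)
  also have "\<dots> = 2 * (\<Sum>j=1..n. nat (int n - \<bar>int j * a\<bar>) * nat (int n - \<bar>int j * b\<bar>))"
    by (rule sum_nonzero_abs) simp
  finally show ?thesis
    by (simp add: abs_mult)
qed

section \<open>Closed forms for the number of attacking pairs\<close>

lemma sum_diff_reverse: "(\<Sum>j=1..n. f (n - j)) = (\<Sum>j<n. f j)" for n :: nat
  by (rule sum.reindex_bij_witness[of _ "\<lambda>j. n - j" "\<lambda>j. n - j"]) auto

lemma card_attacking_pairs_straight:
  assumes "m \<in> {(1, 0), (0, 1)}"
  shows "real (card (attacking_pairs m n)) = real n ^ 3 - real n ^ 2"
proof -
  have "card (attacking_pairs m n) = 2 * (\<Sum>j=1..n. n * (n - j))"
    using assms by (auto simp: card_attacking_pairs nat_diff_distrib mult.commute)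
  also have "(\<Sum>j=1..n. n * (n - j)) = n * (\<Sum>j<n. j)"
    unfolding sum_distrib_left by (rule sum_diff_reverse[of "(*) n"])
  finally have "real (card (attacking_pairs m n)) = n * (2 * real (\<Sum>j<n. j))"
    by simp
  \<comment> \<open>The Gauss sum, doubled to avoid division and stated over the reals to avoid
    truncated subtraction.\<close>
  also have "2 * real (\<Sum>j<n. j) = real n ^ 2 - real n"
    by (induction n) (auto simp: algebra_simps power2_eq_square)
  finally show ?thesis
    by (simp add: algebra_simps power2_eq_square power3_eq_cube)
qed

lemma card_attacking_pairs_diagonal:
  assumes "m \<in> {(1, 1), (1, -1)}"
  shows "real (card (attacking_pairs m n)) = (2 * real n ^ 3 - 3 * real n ^ 2 + real n) / 3"
proof -
  have "card (attacking_pairs m n) = 2 * (\<Sum>j=1..n. (n - j) ^ 2)"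
    using assms by (auto simp: card_attacking_pairs nat_diff_distrib power2_eq_square)
  also have "(\<Sum>j=1..n. (n - j) ^ 2) = (\<Sum>j<n. j ^ 2)"
    by (rule sum_diff_reverse[of "\<lambda>j. j ^ 2"])
  finally have "real (card (attacking_pairs m n)) = 2 * real (\<Sum>j<n. j ^ 2)"
    by simp
  \<comment> \<open>The right-hand side is \<open>(n - 1) n (2 n - 1)\<close> expanded, the usual
    sum of squares below \<open>n\<close>.\<close>
  moreover have "6 * real (\<Sum>j<n. j ^ 2) = 2 * real n ^ 3 - 3 * real n ^ 2 + real n"
    by (induction n) (auto simp: algebra_simps power2_eq_square power3_eq_cube)
  ultimately show ?thesis
    by simp
qed

section \<open>The attack relation and unlabelled placements\<close>

lemma attacks_commute: "attacks M z w \<longleftrightarrow> attacks M w z"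
proof -
  have "attacks M w z" if att: "attacks M z w" for z w
  proof -
    obtain a b c where "(a, b) \<in> M" "w - z = (c * a, c * b)"
      using att by (auto simp: attacks_def)
    then have "(a, b) \<in> M" "z - w = (- c * a, - c * b)"
      by (auto simp: prod_eq_iff)
    then show ?thesis
      unfolding attacks_def by blast
  qed
  then show ?thesis
    by blast
qed

lemma attacks_refl:
  assumes "M \<noteq> {}"
  shows "attacks M z z"
proof -
  obtain a b where "(a, b) \<in> M"
    using assms by auto
  moreover have "z - z = (0 * a, 0 * b)"
    by (simp add: zero_prod_def)
  ultimately show ?thesis
    unfolding attacks_def by blast
qed

text \<open>Multiplier 0 gives the equal squares, and nonzero multipliers give the attacking
  pairs.\<close>

lemma attacks_iff:
  assumes "M \<noteq> {}" "z \<in> board n" "w \<in> board n"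
  shows "attacks M z w \<longleftrightarrow> z = w \<or> (\<exists>m\<in>M. (z, w) \<in> attacking_pairs m n)"
proof
  assume "attacks M z w"
  then obtain a b c where *: "(a, b) \<in> M" "w - z = (c * a, c * b)"
    by (auto simp: attacks_def)
  show "z = w \<or> (\<exists>m\<in>M. (z, w) \<in> attacking_pairs m n)"
  proof (cases "c = 0")
    case True
    then show ?thesis
      using * by (simp add: prod_eq_iff)
  next
    case False
    then have "(z, w) \<in> attacking_pairs (a, b) n"
      using * assms by (auto simp: attacking_pairs_def)
    then show ?thesis
      using * by blast
  qed
next
  assume "z = w \<or> (\<exists>m\<in>M. (z, w) \<in> attacking_pairs m n)"
  then show "attacks M z w"
    using attacks_refl[OF assms(1)] by (fastforce simp: attacks_def attacking_pairs_def)
qed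

text \<open>Labelled placements of two pieces are ordered nonattacking pairs. Nonattack is
  symmetric, and no square is nonattacking with itself, so each unlabelled placement arises from two
  such pairs.\<close>

lemma u_placements_two:
  assumes "M \<noteq> {}"
  shows "2 * u_placements M 2 n = card {(z, w) \<in> board n \<times> board n. \<not> attacks M z w}"
proof -
  let ?P = "{(z, w) \<in> board n \<times> board n. \<not> attacks M z w}"
  have "labelled_placements M 2 n = (\<lambda>(z, w). [z, w]) ` ?P"
  proof
    show "labelled_placements M 2 n \<subseteq> (\<lambda>(z, w). [z, w]) ` ?P"
    proof
      fix zs
      assume zs: "zs \<in> labelled_placements M 2 n"
      then obtain z w where "zs = [z, w]"
        by (auto simp: labelled_placements_def numeral_2_eq_2 length_Suc_conv)
      moreover have "\<not> attacks M (zs ! 0) (zs ! 1)"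
        using zs by (simp add: labelled_placements_def)
      moreover have "set zs \<subseteq> board n"
        using zs by (simp add: labelled_placements_def)
      ultimately show "zs \<in> (\<lambda>(z, w). [z, w]) ` ?P"
        by auto
    qed
    show "(\<lambda>(z, w). [z, w]) ` ?P \<subseteq> labelled_placements M 2 n"
      by (auto simp: labelled_placements_def less_2_cases_iff attacks_commute)
  qed
  then have "mset ` labelled_placements M 2 n = (\<lambda>(z, w). {#z, w#}) ` ?P"
    by (simp add: image_image case_prod_unfold)
  moreover have "card ?P = 2 * card ((\<lambda>(z, w). {#z, w#}) ` ?P)"
  proof (rule card_pairs_eq_twice_card_mset)
    show "finite ?P"
      by (rule finite_subset[of _ "board n \<times> board n"]) (auto simp: finite_board)
  qed (use attacks_commute attacks_refl[OF assms] in auto)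
  ultimately show ?thesis
    by (simp add: u_placements_def)
qed

text \<open>Two distinct basic moves are linearly independent, so they share no nonzero
  multiple.\<close>

lemma disjoint_attacking_pairs:
  assumes "m \<in> {(1, 0), (0, 1), (1, 1), (1, -1)}" "m' \<in> {(1, 0), (0, 1), (1, 1), (1, -1)}" "m \<noteq> m'"
  shows "attacking_pairs m n \<inter> attacking_pairs m' n = {}"
  using assms by (auto simp: attacking_pairs_def)

theorem theorem4p1:
  fixes h k n :: nat and M :: "(int \<times> int) set"
  assumes "h \<in> {0, 1, 2}" and "k \<in> {0, 1, 2}" and "h + k \<ge> 1"
    and "partial_queen_moves h k M"
    and "n \<ge> 1"
  shows "real (u_placements M 2 n) =
           1 / 2 * real n ^ 4 - (3 * real h + 2 * real k) / 6 * real n ^ 3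
           + (real h + real k - 1) / 2 * real n ^ 2 - real k / 6 * real n"
proof -
  obtain H D where H: "H \<subseteq> {(1, 0), (0, 1)}" "card H = h"
    and D: "D \<subseteq> {(1, 1), (1, -1)}" "card D = k" and M: "M = H \<union> D"
    using assms(4) unfolding partial_queen_moves_def by blast
  have fin: "finite H" "finite D"
    using H D by (meson finite.emptyI finite.insertI finite_subset)+
  have "H \<inter> D = {}"
    using H(1) D(1) by fastforce
  have M_sub: "M \<subseteq> {(1, 0), (0, 1), (1, 1), (1, -1)}"
    using H D M by blast
  have "M \<noteq> {}"
    using assms(3) H D M by auto
  let ?B = "board n \<times> board n"
  let ?A = "\<Union>m\<in>M. attacking_pairs m n"
  let ?P = "{(z, w) \<in> ?B. \<not> attacks M z w}"
  have Id: "Id_on (board n) = (\<lambda>z. (z, z)) ` board n"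
    by auto
  have fin_Id: "finite (Id_on (board n))" and fin_A: "finite ?A"
    using M fin finite_attacking_pairs finite_board by (auto simp: Id)
  have fin_P: "finite ?P"
    by (rule finite_subset[of _ ?B]) (auto simp: finite_board)
  have "attacks M z w \<longleftrightarrow> (z, w) \<in> Id_on (board n) \<union> ?A" if "z \<in> board n" "w \<in> board n" for z w
    using attacks_iff[OF \<open>M \<noteq> {}\<close> that] that by auto
  then have "?P = ?B - (Id_on (board n) \<union> ?A)"
    by blast
  moreover have "Id_on (board n) \<union> ?A \<subseteq> ?B"
    unfolding attacking_pairs_def by auto
  ultimately have B: "?B = ?P \<union> (Id_on (board n) \<union> ?A)"
    and disj: "?P \<inter> (Id_on (board n) \<union> ?A) = {}"
    by blast+
  have "card ?B = card ?P + card (Id_on (board n) \<union> ?A)"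
    using card_Un_disjoint[OF fin_P finite_UnI[OF fin_Id fin_A] disj] by (simp only: B[symmetric])
  \<comment> \<open>A nonzero multiple of a basic move is never the zero displacement.\<close>
  moreover have "Id_on (board n) \<inter> ?A = {}"
    using M_sub by (fastforce simp: attacking_pairs_def zero_prod_def)
  then have "card (Id_on (board n) \<union> ?A) = card (Id_on (board n)) + card ?A"
    using fin_Id fin_A by (rule card_Un_disjoint[rotated 2])
  moreover have "card (Id_on (board n)) = n ^ 2"
    unfolding Id by (subst card_image) (auto simp: inj_on_def card_board)
  \<comment> \<open>All ordered pairs of squares split into nonattacking pairs, equal squares, and
    distinct attacking squares.\<close>
  ultimately have "n ^ 2 * n ^ 2 = 2 * u_placements M 2 n + n ^ 2 + card ?A"
    using u_placements_two[OF \<open>M \<noteq> {}\<close>] by (simp add: card_cartesian_product card_board)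
  then have "real (n ^ 2 * n ^ 2) = real (2 * u_placements M 2 n + n ^ 2 + card ?A)"
    by simp
  moreover have "real n ^ 2 * real n ^ 2 = real n ^ 4"
    by (simp flip: power_add)
  ultimately have total: "real n ^ 4 = 2 * real (u_placements M 2 n) + real n ^ 2 + real (card ?A)"
    by simp
  have "card ?A = (\<Sum>m\<in>M. card (attacking_pairs m n))"
  proof (rule card_UN_disjoint)
    show "\<forall>m\<in>M. \<forall>m'\<in>M. m \<noteq> m' \<longrightarrow> attacking_pairs m n \<inter> attacking_pairs m' n = {}"
      using disjoint_attacking_pairs[OF subsetD[OF M_sub] subsetD[OF M_sub]] by simp
  qed (use M fin finite_attacking_pairs in auto)
  \<comment> \<open>The count depends only on whether a move is straight or diagonal, so
    \<open>h\<close> and \<open>k\<close> determine the total although they need not determine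
    \<open>M\<close>.\<close>
  then have "real (card ?A) = (\<Sum>m\<in>H. real (card (attacking_pairs m n)))
      + (\<Sum>m\<in>D. real (card (attacking_pairs m n)))"
    using M fin \<open>H \<inter> D = {}\<close> by (simp add: sum.union_disjoint)
  also have "(\<Sum>m\<in>H. real (card (attacking_pairs m n))) = (\<Sum>m\<in>H. real n ^ 3 - real n ^ 2)"
    using H by (intro sum.cong card_attacking_pairs_straight) auto
  also have "(\<Sum>m\<in>D. real (card (attacking_pairs m n))) =
      (\<Sum>m\<in>D. (2 * real n ^ 3 - 3 * real n ^ 2 + real n) / 3)"
    using D by (intro sum.cong card_attacking_pairs_diagonal) auto
  finally have "real (card ?A) = real h * (real n ^ 3 - real n ^ 2)
      + real k * ((2 * real n ^ 3 - 3 * real n ^ 2 + real n) / 3)"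
    using H D by simp
  then show ?thesis
    using total by (simp add: field_simps)
qed

end
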